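(* Let $p:E\to B$ and $p':E'\to B'$ be (Hurewicz) fibrations. Suppose $h:E\to E'$ and $\bar{h}:B\to B'$ are homotopy equivalences such that $p'\circ h=\bar{h}\circ p$. Then $$\mathsf{TC}[p:E\to B]=\mathsf{TC}[p':E'\to B'].$$
   Context: A (Hurewicz) fibration is a map having the homotopy lifting property with respect to all spaces. Sectional category: for a map $p:E\to B$ of topological spaces, $\mathsf{secat}(p)\in\{0,1,2,\ldots\}\cup\{\infty\}$ is the smallest $k$ such that $B$ admits a cover by open sets $U_0,\ldots,U_k$, each of which admits a map $\sigma_i:U_i\to E$ with $p\circ\sigma_i$ homotopic to the inclusion $U_i\hookrightarrow B$ (and $\infty$ if no such $k$ exists). Parametrised topological complexity: for a fibration $p:E\to B$, let $I=[0,1]$, let $E^I_B=\{\gamma:I\to E \mid p(\gamma(t))=p(\gamma(0))\text{ for all }t\in I\}$ be the space of paths in $E$ contained in a single fibre of $p$, and let $E\times_B E=\{(e_1,e_2)\in E\times E\mid p(e_1)=p(e_2)\}$. The parametrised endpoint map is $\Pi:E^I_B\to E\times_B E$, $\Pi(\gamma)=(\gamma(0),\gamma(1))$ (it is a fibration since $p$ is). Then $\mathsf{TC}[p:E\to B]:=\mathsf{secat}(\Pi)$. *)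

theory Defs
  imports "HOL-Analysis.Analysis"
begin

definition homotopy_equivalence_map ::
    "'a topology \<Rightarrow> 'b topology \<Rightarrow> ('a \<Rightarrow> 'b) \<Rightarrow> bool" where
  "homotopy_equivalence_map X Y f \<longleftrightarrow>
     continuous_map X Y f \<and>
     (\<exists>g. continuous_map Y X g \<and>
          homotopic_with (\<lambda>_. True) X X (g \<circ> f) id \<and>
          homotopic_with (\<lambda>_. True) Y Y (f \<circ> g) id)"

definition homotopy_lifting_property ::
    "'x topology \<Rightarrow> 'a topology \<Rightarrow> 'b topology \<Rightarrow> ('a \<Rightarrow> 'b) \<Rightarrow> bool" where
  "homotopy_lifting_property X E B p \<longleftrightarrow>
     (\<forall>f H. continuous_map X E f \<and>
            continuous_map (prod_topology (top_of_set {0..1::real}) X) B H \<and>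
            (\<forall>x\<in>topspace X. H (0, x) = p (f x)) \<longrightarrow>
            (\<exists>K. continuous_map (prod_topology (top_of_set {0..1::real}) X) E K \<and>
                 (\<forall>x\<in>topspace X. K (0, x) = f x) \<and>
                 (\<forall>t\<in>{0..1}. \<forall>x\<in>topspace X. p (K (t, x)) = H (t, x))))"

text \<open>
  A definition in HOL cannot quantify over all types, so the test spaces are the topologies
  on one type, large enough to contain the underlying set of \<open>E \<times>\<^sub>B B\<^sup>I\<close>. The lifting property
  then holds for test spaces on every type: see \<open>hurewicz_fibration_lifting\<close> below.
\<close>

definition hurewicz_fibration ::
    "'a topology \<Rightarrow> 'b topology \<Rightarrow> ('a \<Rightarrow> 'b) \<Rightarrow> bool" where
  "hurewicz_fibration E B p \<longleftrightarrow>
     continuous_map E B p \<and>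
     (\<forall>X :: ('a \<times> (real \<Rightarrow> 'b)) topology. homotopy_lifting_property X E B p)"

lemma quotient_topology_exists:
  fixes X :: "'x topology" and e :: "'x \<Rightarrow> 'y"
  obtains Q where "quotient_map X Q e"
proof -
  define op where "op = (\<lambda>U. U \<subseteq> e ` topspace X \<and> openin X {x \<in> topspace X. e x \<in> U})"
  have int: "op (S \<inter> T)" if "op S" "op T" for S T
  proof -
    have "{x \<in> topspace X. e x \<in> S \<inter> T} =
          {x \<in> topspace X. e x \<in> S} \<inter> {x \<in> topspace X. e x \<in> T}" by auto
    with that show ?thesis unfolding op_def by auto
  qed
  have un: "op (\<Union>\<K>)" if "\<And>K. K \<in> \<K> \<Longrightarrow> op K" for \<K>
  proof -
    have "{x \<in> topspace X. e x \<in> \<Union>\<K>} = \<Union>((\<lambda>K. {x \<in> topspace X. e x \<in> K}) ` \<K>)" by auto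
    moreover have "openin X \<dots>" using that unfolding op_def by auto
    moreover have "\<Union>\<K> \<subseteq> e ` topspace X"
      using that unfolding op_def by (intro Union_least) blast
    ultimately show ?thesis unfolding op_def by simp
  qed
  have "istopology op" unfolding istopology_def using int un by blast
  then have op: "openin (topology op) = op" by (rule topology_inverse')
  have "op (e ` topspace X)"
  proof -
    have "{x \<in> topspace X. e x \<in> e ` topspace X} = topspace X" by auto
    then show ?thesis unfolding op_def by auto
  qed
  then have ts: "topspace (topology op) = e ` topspace X"
    by (metis (no_types, lifting) op op_def openin_subset openin_topspace subset_antisym)
  have "quotient_map X (topology op) e"
    unfolding quotient_map_def ts op by (auto simp: op_def)
  then show thesis by (rule that)
qed

lemma hurewicz_fibration_lifting:
  fixes X :: "'x topology" and E :: "'a topology" and B :: "'b topology"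
  assumes "hurewicz_fibration E B p"
  shows "homotopy_lifting_property X E B p"
  unfolding homotopy_lifting_property_def
proof (intro allI impI, elim conjE)
  fix f H
  let ?I = "top_of_set {0..1::real}"
  assume f: "continuous_map X E f"
    and H: "continuous_map (prod_topology ?I X) B H"
    and H0: "\<forall>x\<in>topspace X. H (0, x) = p (f x)"
  define e :: "'x \<Rightarrow> 'a \<times> (real \<Rightarrow> 'b)" where "e = (\<lambda>x. (f x, \<lambda>t\<in>{0..1}. H (t, x)))"
  obtain Q where Q: "quotient_map X Q e" by (rule quotient_topology_exists)
  have im: "topspace Q = e ` topspace X"
    using Q quotient_imp_surjective_map by blast
  have q: "quotient_map (prod_topology ?I X) (prod_topology ?I Q) (\<lambda>(t, x). (t, e x))"
  proof (rule quotient_map_prod_right)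
    show "locally_compact_space ?I"
      by (intro compact_imp_locally_compact_space compact_space_subtopology) simp
    show "Hausdorff_space ?I \<or> regular_space ?I"
      by (simp add: Hausdorff_space_subtopology)
  qed (rule Q)
  have "continuous_map X E (fst \<circ> e)" using f by (simp add: e_def o_def)
  then have cf: "continuous_map Q E fst"
    by (rule continuous_compose_quotient_map [OF Q])
  define G :: "real \<times> ('a \<times> (real \<Rightarrow> 'b)) \<Rightarrow> 'b" where "G = (\<lambda>(t, y). snd y t)"
  have "continuous_map (prod_topology ?I X) B (G \<circ> (\<lambda>(t, x). (t, e x)))"
    by (rule continuous_map_eq [OF H]) (auto simp: G_def e_def)
  then have cG: "continuous_map (prod_topology ?I Q) B G"
    by (rule continuous_compose_quotient_map [OF q])
  have G0: "\<forall>y\<in>topspace Q. G (0, y) = p (fst y)"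
    using H0 by (auto simp: im G_def e_def)
  have "homotopy_lifting_property Q E B p"
    using assms by (simp add: hurewicz_fibration_def)
  from this [unfolded homotopy_lifting_property_def, rule_format, OF conjI, OF cf conjI, OF cG] G0
  obtain K where K: "continuous_map (prod_topology ?I Q) E K"
    "\<forall>y\<in>topspace Q. K (0, y) = fst y"
    "\<forall>t\<in>{0..1}. \<forall>y\<in>topspace Q. p (K (t, y)) = G (t, y)"
    by blast
  have "continuous_map (prod_topology ?I X) E (K \<circ> (\<lambda>(t, x). (t, e x)))"
    by (rule continuous_map_compose [OF quotient_imp_continuous_map [OF q] K(1)])
  moreover have "\<forall>x\<in>topspace X. (K \<circ> (\<lambda>(t, x). (t, e x))) (0, x) = f x"
    using K(2) by (auto simp: im e_def)
  moreover have "\<forall>t\<in>{0..1}. \<forall>x\<in>topspace X.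
      p ((K \<circ> (\<lambda>(t, x). (t, e x))) (t, x)) = H (t, x)"
    using K(3) by (auto simp: im e_def G_def)
  ultimately show "\<exists>K. continuous_map (prod_topology ?I X) E K \<and>
      (\<forall>x\<in>topspace X. K (0, x) = f x) \<and>
      (\<forall>t\<in>{0..1}. \<forall>x\<in>topspace X. p (K (t, x)) = H (t, x))"
    by blast
qed

text \<open>
  The infimum is taken in \<^typ>\<open>enat\<close>, where \<^term>\<open>Inf {} = (\<infinity> :: enat)\<close>.
\<close>

definition secat :: "'a topology \<Rightarrow> 'b topology \<Rightarrow> ('a \<Rightarrow> 'b) \<Rightarrow> enat" where
  "secat E B p =
     Inf {enat k | k. \<exists>U :: nat \<Rightarrow> 'b set.
       (\<forall>i\<le>k. openin B (U i)) \<and> (\<Union>i\<le>k. U i) = topspace B \<and>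
       (\<forall>i\<le>k. \<exists>\<sigma>. continuous_map (subtopology B (U i)) E \<sigma> \<and>
          homotopic_with (\<lambda>_. True) (subtopology B (U i)) B (p \<circ> \<sigma>) id)}"

text \<open>
  The compact-open topology on the continuous maps from \<open>X\<close> to \<open>Y\<close>. Maps are represented by
  extensional functions, so that two of them are equal iff they agree on \<open>topspace X\<close>.
\<close>

definition compact_open_topology ::
    "'a topology \<Rightarrow> 'b topology \<Rightarrow> ('a \<Rightarrow> 'b) topology" where
  "compact_open_topology X Y =
     topology_generated_by
       {{f \<in> extensional (topspace X). continuous_map X Y f \<and> f ` K \<subseteq> U} | K U.
          compactin X K \<and> openin Y U}"

lemma topspace_compact_open_topology:
  "topspace (compact_open_topology X Y) =
     {f \<in> extensional (topspace X). continuous_map X Y f}"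
proof -
  let ?S = "\<lambda>K U. {f \<in> extensional (topspace X). continuous_map X Y f \<and> f ` K \<subseteq> U}"
  have "?S {} {} \<in> {?S K U | K U. compactin X K \<and> openin Y U}"
    by (rule CollectI, rule exI [of _ "{}"], rule exI [of _ "{}"]) simp
  then have "?S {} {} \<subseteq> topspace (compact_open_topology X Y)"
    unfolding compact_open_topology_def topology_generated_by_topspace by (rule Union_upper)
  moreover have "topspace (compact_open_topology X Y) \<subseteq> ?S {} {}"
    unfolding compact_open_topology_def topology_generated_by_topspace
    by (rule Union_least) auto
  ultimately show ?thesis by auto
qed

text \<open>
  The spaces \<open>E\<^sup>I\<^sub>B\<close> and \<open>E \<times>\<^sub>B E\<close>. They depend only on the fibres of \<open>p\<close>, so the topology
  of \<open>B\<close> is not an argument here or in the definition of \<open>TC[p : E \<rightarrow> B]\<close>.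
\<close>

definition fibrewise_path_space ::
    "'a topology \<Rightarrow> ('a \<Rightarrow> 'b) \<Rightarrow> (real \<Rightarrow> 'a) topology" where
  "fibrewise_path_space E p =
     subtopology (compact_open_topology (top_of_set {0..1::real}) E)
       {\<gamma>. \<forall>t\<in>{0..1}. p (\<gamma> t) = p (\<gamma> 0)}"

definition fibre_square :: "'a topology \<Rightarrow> ('a \<Rightarrow> 'b) \<Rightarrow> ('a \<times> 'a) topology" where
  "fibre_square E p = subtopology (prod_topology E E) {(e1, e2). p e1 = p e2}"

definition endpoint_map :: "(real \<Rightarrow> 'a) \<Rightarrow> 'a \<times> 'a" where
  "endpoint_map \<gamma> = (\<gamma> 0, \<gamma> 1)"

definition parametrised_TC :: "'a topology \<Rightarrow> ('a \<Rightarrow> 'b) \<Rightarrow> enat" where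
  "parametrised_TC E p = secat (fibrewise_path_space E p) (fibre_square E p) endpoint_map"

end

theory Submission
  imports Defs
begin

text \<open>
  The homotopy inverse \<open>gbar\<close> of \<open>hbar\<close> is covered by a homotopy inverse \<open>g\<close> of \<open>h\<close>: lift the
  homotopy from \<open>p \<circ> g\<^sub>0\<close> to \<open>gbar \<circ> p'\<close>, where \<open>g\<^sub>0\<close> is any homotopy inverse of \<open>h\<close>. Lifting
  the homotopy from \<open>gbar \<circ> hbar\<close> to the identity deforms \<open>g \<circ> h\<close> to a map \<open>k\<close> over \<open>B\<close> that is
  homotopic to the identity, and by Dold's argument \<open>k\<close> has a left inverse \<open>l\<close> up to homotopy over
  \<open>B\<close>. So \<open>l \<circ> g \<circ> h\<close> is homotopic to the identity through maps that send fibres into fibres,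
  and motion planners for \<open>p'\<close> pull back along \<open>h\<close> to motion planners for \<open>p\<close>. The pair
  \<open>(l \<circ> g, gbar)\<close> satisfies the hypotheses in the other direction, which gives the converse
  inequality.
\<close>

section \<open>Lifting, reparametrising and building homotopies\<close>

lemma fibration_continuous_map: "hurewicz_fibration E B p \<Longrightarrow> continuous_map E B p"
  by (simp add: hurewicz_fibration_def)

lemma fibration_lift:
  assumes "hurewicz_fibration E B p" "continuous_map X E f"
    and "continuous_map (prod_topology (top_of_set {0..1::real}) X) B H"
    and "\<And>x. x \<in> topspace X \<Longrightarrow> H (0, x) = p (f x)"
  obtains K where "continuous_map (prod_topology (top_of_set {0..1::real}) X) E K"
    and "\<And>x. x \<in> topspace X \<Longrightarrow> K (0, x) = f x"
    and "\<And>t x. t \<in> {0..1} \<Longrightarrow> x \<in> topspace X \<Longrightarrow> p (K (t, x)) = H (t, x)"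
  using hurewicz_fibration_lifting [OF assms(1), of X] assms(2-)
  unfolding homotopy_lifting_property_def by metis

lemma continuous_map_unit_interval_fst:
  "continuous_map (prod_topology (top_of_set {0..1::real}) X) euclideanreal fst"
  using continuous_map_fst continuous_map_into_fulltopology by blast

lemma continuous_map_reparametrise:
  assumes "continuous_map (prod_topology (top_of_set {0..1::real}) X) Y H"
    and "continuous_map Z euclideanreal \<phi>" "\<And>z. z \<in> topspace Z \<Longrightarrow> \<phi> z \<in> {0..1}"
    and "continuous_map Z X f"
  shows "continuous_map Z Y (\<lambda>z. H (\<phi> z, f z))"
proof -
  have "continuous_map Z (prod_topology (top_of_set {0..1}) X) (\<lambda>z. (\<phi> z, f z))"
    using assms by (auto simp: continuous_map_paired continuous_map_in_subtopology)
  from continuous_map_compose [OF this assms(1)] show ?thesis by (simp add: o_def)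
qed

text \<open>The congruence condition on \<open>P\<close> lets the endpoints be checked on
  \<open>topspace X\<close> alone; the homotopies built from lifts are only controlled
  there.\<close>

lemma homotopic_withI:
  assumes "continuous_map (prod_topology (top_of_set {0..1::real}) X) Y H"
    and "\<And>x. x \<in> topspace X \<Longrightarrow> H (0, x) = f x" "\<And>x. x \<in> topspace X \<Longrightarrow> H (1, x) = g x"
    and "\<And>t. t \<in> {0..1} \<Longrightarrow> P (\<lambda>x. H (t, x))"
    and "\<And>h k. (\<And>x. x \<in> topspace X \<Longrightarrow> h x = k x) \<Longrightarrow> P h \<longleftrightarrow> P k"
  shows "homotopic_with P X Y f g"
  using assms(1-4) by (subst homotopic_with [OF assms(5)]) auto

section \<open>Uniqueness of lifts up to homotopy in the fibres, and Dold's left inverse\<close>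

text \<open>
  The concatenation of \<open>K\<close> with the reverse of \<open>L\<close> lies over the path that runs through \<open>W\<close> and
  back. Lifting the contraction of that path to its start gives, on three sides of the
  square, a homotopy inside the fibres.
\<close>

lemma homotopy_lifts_fibre_homotopic:
  assumes fib: "hurewicz_fibration E B p"
    and W: "continuous_map (prod_topology (top_of_set {0..1::real}) X) B W"
    and K: "continuous_map (prod_topology (top_of_set {0..1}) X) E K"
    and L: "continuous_map (prod_topology (top_of_set {0..1}) X) E L"
    and pK: "\<And>t x. t \<in> {0..1} \<Longrightarrow> x \<in> topspace X \<Longrightarrow> p (K (t, x)) = W (t, x)"
    and pL: "\<And>t x. t \<in> {0..1} \<Longrightarrow> x \<in> topspace X \<Longrightarrow> p (L (t, x)) = W (t, x)"
    and KL: "\<And>x. x \<in> topspace X \<Longrightarrow> K (1, x) = L (1, x)"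
  shows "homotopic_with (\<lambda>f. \<forall>x\<in>topspace X. p (f x) = W (0, x)) X E
           (\<lambda>x. K (0, x)) (\<lambda>x. L (0, x))"
proof -
  let ?I = "top_of_set {0..1::real}"
  let ?P = "\<lambda>f. \<forall>x\<in>topspace X. p (f x) = W (0, x)"
  have P_cong: "?P f \<longleftrightarrow> ?P g" if "\<And>x. x \<in> topspace X \<Longrightarrow> f x = g x" for f g
    using that by simp
  define M where "M = (\<lambda>(t, x). if t \<le> 1/2 then K (2 * t, x) else L (2 - 2 * t, x))"
  have fst: "continuous_map (subtopology (prod_topology ?I X) S) euclideanreal fst" for S
    by (intro continuous_map_from_subtopology continuous_map_unit_interval_fst)
  have snd: "continuous_map (subtopology (prod_topology ?I X) S) X snd" for S
    by (intro continuous_map_from_subtopology continuous_map_snd)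
  have M: "continuous_map (prod_topology ?I X) E M"
    unfolding M_def case_prod_unfold
  proof (rule continuous_map_cases_le)
    show "continuous_map (prod_topology ?I X) euclideanreal fst"
      by (rule continuous_map_unit_interval_fst)
    show "continuous_map (subtopology (prod_topology ?I X) {z \<in> topspace (prod_topology ?I X). fst z \<le> 1/2})
        E (\<lambda>z. K (2 * fst z, snd z))"
      by (rule continuous_map_reparametrise [OF K _ _ snd]) (auto intro!: continuous_intros fst)
    show "continuous_map (subtopology (prod_topology ?I X) {z \<in> topspace (prod_topology ?I X). 1/2 \<le> fst z})
        E (\<lambda>z. L (2 - 2 * fst z, snd z))"
      by (rule continuous_map_reparametrise [OF L _ _ snd]) (auto intro!: continuous_intros fst)
    show "K (2 * fst z, snd z) = L (2 - 2 * fst z, snd z)"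
      if "z \<in> topspace (prod_topology ?I X)" "fst z = 1/2" for z
      unfolding that(2) using that(1) by (auto simp: KL)
  qed auto
  \<comment> \<open>The height \<open>min (2 * t) (2 - 2 * t)\<close> rises from 0 to 1 and falls
    back to 0, so \<open>M\<close> lies over \<open>W\<close> run forwards and then
    backwards.\<close>
  have pM: "p (M (t, x)) = W (min (2 * t) (2 - 2 * t), x)"
    if "t \<in> {0..1}" "x \<in> topspace X" for t x
    using that by (auto simp: M_def pK pL min_def)
  \<comment> \<open>The factor \<open>1 - s\<close> shrinks the height to 0. Hence \<open>S\<close>
    is \<open>p \<circ> M\<close> at \<open>s = 0\<close>, and is \<open>W (0, x)\<close> on the
    sides \<open>t = 0\<close>, \<open>t = 1\<close> and \<open>s = 1\<close>.\<close>
  define S where "S = (\<lambda>(s::real, t, x). W ((1 - s) * min (2 * t) (2 - 2 * t), x))"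
  have bounds: "(1 - s) * min (2 * t) (2 - 2 * t) \<in> {0..1}" if "s \<in> {0..1}" "t \<in> {0..1}" for s t :: real
    using that by (auto intro!: mult_le_one)
  have S: "continuous_map (prod_topology ?I (prod_topology ?I X)) B S"
    unfolding S_def case_prod_unfold
  proof (rule continuous_map_reparametrise [OF W])
    have fst_snd: "continuous_map (prod_topology ?I (prod_topology ?I X)) euclideanreal (\<lambda>z. fst (snd z))"
      using continuous_map_compose [OF continuous_map_snd continuous_map_unit_interval_fst, of ?I X]
      by (simp add: o_def)
    show "continuous_map (prod_topology ?I (prod_topology ?I X)) euclideanreal
        (\<lambda>z. (1 - fst z) * min (2 * fst (snd z)) (2 - 2 * fst (snd z)))"
      by (intro continuous_intros continuous_map_real_min
          continuous_map_unit_interval_fst fst_snd)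
    show "continuous_map (prod_topology ?I (prod_topology ?I X)) X (\<lambda>z. snd (snd z))"
      using continuous_map_compose [OF continuous_map_snd continuous_map_snd, of ?I ?I X]
      by (simp add: o_def)
  qed (use bounds in \<open>auto simp del: min_less_iff_conj\<close>)
  obtain T where T: "continuous_map (prod_topology ?I (prod_topology ?I X)) E T"
    and T0: "\<And>z. z \<in> topspace (prod_topology ?I X) \<Longrightarrow> T (0, z) = M z"
    and pT: "\<And>s z. s \<in> {0..1} \<Longrightarrow> z \<in> topspace (prod_topology ?I X) \<Longrightarrow> p (T (s, z)) = S (s, z)"
    by (rule fibration_lift [OF fib M S]) (auto simp: S_def pM)
  have side: "homotopic_with ?P X E (\<lambda>x. T (0, c, x)) (\<lambda>x. T (1, c, x))" if "c = 0 \<or> c = 1" for c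
  proof (rule homotopic_withI [OF _ _ _ _ P_cong])
    show "continuous_map (prod_topology ?I X) E (\<lambda>z. T (fst z, c, snd z))"
      by (rule continuous_map_reparametrise [OF T])
        (use that in \<open>auto simp: continuous_map_unit_interval_fst continuous_map_paired continuous_map_snd\<close>)
  qed (use that in \<open>auto simp: pT S_def\<close>)
  have "homotopic_with ?P X E (\<lambda>x. T (1, 0, x)) (\<lambda>x. T (1, 1, x))"
  proof (rule homotopic_withI [OF _ _ _ _ P_cong])
    show "continuous_map (prod_topology ?I X) E (\<lambda>z. T (1, z))"
      by (rule continuous_map_reparametrise [OF T]) auto
  qed (auto simp: pT S_def)
  \<comment> \<open>The route goes up the side \<open>t = 0\<close>, across \<open>s = 1\<close> and
    down the side \<open>t = 1\<close>. Its ends are \<open>M (0, x) = K (0, x)\<close> and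
    \<open>M (1, x) = L (0, x)\<close>.\<close>
  then have "homotopic_with ?P X E (\<lambda>x. T (0, 0, x)) (\<lambda>x. T (0, 1, x))"
    using side [of 0] side [of 1] homotopic_with_trans homotopic_with_symD by blast
  then show ?thesis
    by (rule homotopic_with_eq) (auto simp: T0 M_def)
qed

text \<open>
  If \<open>F\<close> is a homotopy from \<open>k\<close> to the identity and \<open>L\<close> lifts \<open>p \<circ> F\<close> with \<open>L\<^sub>0 = id\<close>, then
  \<open>l = L\<^sub>1\<close> works, because \<open>l \<circ> F\<close> and \<open>L\<close> are lifts of \<open>p \<circ> F\<close> that both end at \<open>l\<close>.
\<close>

lemma fibrewise_left_inverse:
  assumes fib: "hurewicz_fibration E B p"
    and pk: "\<And>x. x \<in> topspace E \<Longrightarrow> p (k x) = p x"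
    and k: "homotopic_with (\<lambda>_. True) E E k id"
  obtains l where "homotopic_with (\<lambda>_. True) E E l id"
    and "\<And>x. x \<in> topspace E \<Longrightarrow> p (l x) = p x"
    and "homotopic_with (\<lambda>f. \<forall>x\<in>topspace E. p (f x) = p x) E E (l \<circ> k) id"
proof -
  let ?I = "top_of_set {0..1::real}"
  obtain F where F: "continuous_map (prod_topology ?I E) E F"
    and F0: "\<And>x. F (0, x) = k x" and F1: "\<And>x. F (1, x) = x"
    using k by (auto simp: homotopic_with_def)
  have pF: "continuous_map (prod_topology ?I E) B (p \<circ> F)"
    using F fib by (intro continuous_map_compose [OF F] fibration_continuous_map)
  obtain L where L: "continuous_map (prod_topology ?I E) E L"
    and L0: "\<And>x. x \<in> topspace E \<Longrightarrow> L (0, x) = id x"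
    and pL: "\<And>t x. t \<in> {0..1} \<Longrightarrow> x \<in> topspace E \<Longrightarrow> p (L (t, x)) = (p \<circ> F) (t, x)"
    by (rule fibration_lift [OF fib continuous_map_id pF]) (auto simp: F0 pk)
  define l where "l = (\<lambda>x. L (1, x))"
  have pl: "p (l x) = p x" if "x \<in> topspace E" for x
    using that by (simp add: l_def pL F1)
  have l_id: "homotopic_with (\<lambda>_. True) E E l id"
    by (rule homotopic_with_symD, rule homotopic_withI [OF L]) (auto simp: L0 l_def)
  then have l: "continuous_map E E l"
    by (simp add: homotopic_with_imp_continuous_maps)
  have FE: "F (t, x) \<in> topspace E" if "t \<in> {0..1}" "x \<in> topspace E" for t x
    using continuous_map_image_subset_topspace [OF F] that by auto
  have "homotopic_with (\<lambda>f. \<forall>x\<in>topspace E. p (f x) = (p \<circ> F) (0, x)) E E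
      (\<lambda>x. (l \<circ> F) (0, x)) (\<lambda>x. L (0, x))"
    using pF continuous_map_compose [OF F l] L
    by (rule homotopy_lifts_fibre_homotopic [OF fib]) (auto simp: pl FE pL F1 l_def)
  then have "homotopic_with (\<lambda>f. \<forall>x\<in>topspace E. p (f x) = (p \<circ> F) (0, x)) E E (l \<circ> k) id"
    by (rule homotopic_with_eq) (auto simp: F0 L0)
  then have "homotopic_with (\<lambda>f. \<forall>x\<in>topspace E. p (f x) = p x) E E (l \<circ> k) id"
    by (rule homotopic_with_mono) (auto simp: F0 pk)
  with l_id pl show thesis by (rule that)
qed

section \<open>Fibre-preserving maps and a left inverse of \<open>h\<close> among them\<close>

text \<open>This says that \<open>f\<close> covers some function between the bases, which is left
  unnamed: it varies along the homotopies used below, and fibrewise paths and fibre squares see only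
  the fibres.\<close>

definition fibre_preserving :: "'a topology \<Rightarrow> ('a \<Rightarrow> 'b) \<Rightarrow> ('c \<Rightarrow> 'd) \<Rightarrow> ('a \<Rightarrow> 'c) \<Rightarrow> bool" where
  "fibre_preserving E p p' f \<longleftrightarrow>
     (\<forall>x\<in>topspace E. \<forall>y\<in>topspace E. p x = p y \<longrightarrow> p' (f x) = p' (f y))"

lemma fibre_preservingD:
  assumes "fibre_preserving E p p' f" "x \<in> topspace E" "y \<in> topspace E" "p x = p y"
  shows "p' (f x) = p' (f y)"
  using assms unfolding fibre_preserving_def by blast

lemma homotopic_compose_cancel:
  assumes "homotopic_with (\<lambda>_. True) X X l id" "continuous_map Y X f"
  shows "homotopic_with (\<lambda>_. True) Y X (l \<circ> f) f"
  using homotopic_with_compose_continuous_map_right [OF assms, of "\<lambda>_. True"] by simp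

text \<open>The pair \<open>g\<close>, \<open>gbar\<close> again consists of homotopy equivalences
  commuting with the projections, so the lemma can be applied once more with the two fibrations
  exchanged.\<close>

lemma fibration_map_left_inverse:
  assumes fib: "hurewicz_fibration E B p"
    and p': "continuous_map E' B' p'"
    and h: "homotopy_equivalence_map E E' h"
    and hbar: "homotopy_equivalence_map B B' hbar"
    and comm: "\<And>x. x \<in> topspace E \<Longrightarrow> p' (h x) = hbar (p x)"
  obtains g gbar where "homotopy_equivalence_map E' E g" "homotopy_equivalence_map B' B gbar"
    and "\<And>y. y \<in> topspace E' \<Longrightarrow> p (g y) = gbar (p' y)"
    and "homotopic_with (fibre_preserving E p p) E E (g \<circ> h) id"
proof -
  let ?I = "top_of_set {0..1::real}" and ?T = "\<lambda>_. True"
  have p: "continuous_map E B p" by (rule fibration_continuous_map [OF fib])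
  obtain g0 where ch: "continuous_map E E' h" and g0: "continuous_map E' E g0"
    and g0h: "homotopic_with ?T E E (g0 \<circ> h) id" and hg0: "homotopic_with ?T E' E' (h \<circ> g0) id"
    using h by (auto simp: homotopy_equivalence_map_def)
  obtain gbar where chb: "continuous_map B B' hbar" and gb: "continuous_map B' B gbar"
    and gbhb: "homotopic_with ?T B B (gbar \<circ> hbar) id"
    and hbgb: "homotopic_with ?T B' B' (hbar \<circ> gbar) id"
    using hbar by (auto simp: homotopy_equivalence_map_def)

  \<comment> \<open>The chain is \<open>p \<circ> g0\<close> ~
    \<open>gbar \<circ> hbar \<circ> p \<circ> g0\<close> =
    \<open>gbar \<circ> p' \<circ> h \<circ> g0\<close> ~ \<open>gbar \<circ> p'\<close>, with
    \<open>comm\<close> giving the equality in the middle.\<close>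
  have "homotopic_with ?T E' B (p \<circ> g0) (gbar \<circ> hbar \<circ> (p \<circ> g0))"
    using homotopic_compose_cancel [OF gbhb continuous_map_compose [OF g0 p]]
    by (rule homotopic_with_symD)
  moreover have "homotopic_with ?T E' B (gbar \<circ> p' \<circ> (h \<circ> g0)) (gbar \<circ> p' \<circ> id)"
    by (rule homotopic_with_compose_continuous_map_left [OF hg0])
      (auto intro: continuous_map_compose p' gb)
  then have "homotopic_with ?T E' B (gbar \<circ> hbar \<circ> (p \<circ> g0)) (gbar \<circ> p')"
    by (rule homotopic_with_eq)
      (use continuous_map_image_subset_topspace [OF g0] in \<open>auto simp: comm\<close>)
  ultimately have "homotopic_with ?T E' B (p \<circ> g0) (gbar \<circ> p')"
    by (rule homotopic_with_trans)
  then obtain G where G: "continuous_map (prod_topology ?I E') B G"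
    and G0: "\<And>y. G (0, y) = p (g0 y)" and G1: "\<And>y. G (1, y) = gbar (p' y)"
    by (auto simp: homotopic_with_def)
  obtain GL where GL: "continuous_map (prod_topology ?I E') E GL"
    and GL0: "\<And>y. y \<in> topspace E' \<Longrightarrow> GL (0, y) = g0 y"
    and pGL: "\<And>t y. t \<in> {0..1} \<Longrightarrow> y \<in> topspace E' \<Longrightarrow> p (GL (t, y)) = G (t, y)"
    by (rule fibration_lift [OF fib g0 G]) (auto simp: G0)
  define g where "g = (\<lambda>y. GL (1, y))"
  have pg: "p (g y) = gbar (p' y)" if "y \<in> topspace E'" for y
    using that by (simp add: g_def pGL G1)
  have g0g: "homotopic_with ?T E' E g g0"
    by (rule homotopic_with_symD, rule homotopic_withI [OF GL]) (auto simp: GL0 g_def)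
  then have g: "continuous_map E' E g" by (simp add: homotopic_with_imp_continuous_maps)
  have gh: "homotopic_with ?T E E (g \<circ> h) id"
    using homotopic_with_compose_continuous_map_right [OF g0g ch, of ?T] g0h
      homotopic_with_trans by auto
  have hg: "homotopic_with ?T E' E' (h \<circ> g) id"
    using homotopic_with_compose_continuous_map_left [OF g0g ch, of ?T] hg0
      homotopic_with_trans by auto

  obtain J where J: "continuous_map (prod_topology ?I B) B J"
    and J0: "\<And>b. J (0, b) = gbar (hbar b)" and J1: "\<And>b. J (1, b) = b"
    using gbhb by (auto simp: homotopic_with_def)
  have Jp: "continuous_map (prod_topology ?I E) B (\<lambda>z. J (fst z, p (snd z)))"
    using continuous_map_compose [OF continuous_map_snd p]
    by (intro continuous_map_reparametrise [OF J continuous_map_unit_interval_fst]) (auto simp: o_def)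
  \<comment> \<open>The lift can start at \<open>g \<circ> h\<close> because \<open>p \<circ> g
    \<circ> h = gbar \<circ> p' \<circ> h = gbar \<circ> hbar \<circ> p\<close> on \<open>E\<close>.
    Its end lies over \<open>J\<close> at time 1, the identity.\<close>
  obtain N where N: "continuous_map (prod_topology ?I E) E N"
    and N0: "\<And>x. x \<in> topspace E \<Longrightarrow> N (0, x) = (g \<circ> h) x"
    and pN: "\<And>t x. t \<in> {0..1} \<Longrightarrow> x \<in> topspace E \<Longrightarrow> p (N (t, x)) = J (fst (t, x), p (snd (t, x)))"
    by (rule fibration_lift [OF fib continuous_map_compose [OF ch g] Jp])
      (use continuous_map_image_subset_topspace [OF ch] in \<open>auto simp: J0 pg comm\<close>)
  define k where "k = (\<lambda>x. N (1, x))"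
  have pk: "p (k x) = p x" if "x \<in> topspace E" for x
    using that by (simp add: k_def pN J1)
  \<comment> \<open>The stage of \<open>N\<close> at time \<open>t\<close> covers the stage of
    \<open>J\<close> at time \<open>t\<close>, so points of one fibre stay in one fibre.\<close>
  have ghk: "homotopic_with (fibre_preserving E p p) E E (g \<circ> h) k"
    by (rule homotopic_withI [OF N])
      (auto simp: N0 k_def fibre_preserving_def pN)
  then have "homotopic_with ?T E E (g \<circ> h) k"
    by (rule homotopic_with_mono) simp
  with gh have kid: "homotopic_with ?T E E k id"
    using homotopic_with_trans homotopic_with_symD by blast
  obtain l where l: "homotopic_with ?T E E l id"
    and pl: "\<And>x. x \<in> topspace E \<Longrightarrow> p (l x) = p x"
    and lk: "homotopic_with (\<lambda>f. \<forall>x\<in>topspace E. p (f x) = p x) E E (l \<circ> k) id"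
    using fibrewise_left_inverse [OF fib pk kid] by blast
  have cl: "continuous_map E E l" using l by (simp add: homotopic_with_imp_continuous_maps)
  \<comment> \<open>Composing with \<open>l\<close> keeps the stages of \<open>N\<close> over those
    of \<open>J\<close>, since \<open>l\<close> lies over the identity of \<open>B\<close>.\<close>
  have lN: "homotopic_with (fibre_preserving E p p) E E (l \<circ> g \<circ> h) (l \<circ> k)"
  proof (rule homotopic_withI [OF continuous_map_compose [OF N cl]])
    have NE: "N (t, x) \<in> topspace E" if "t \<in> {0..1}" "x \<in> topspace E" for t x
      using continuous_map_image_subset_topspace [OF N] that by auto
    show "fibre_preserving E p p (\<lambda>x. (l \<circ> N) (t, x))" if "t \<in> {0..1}" for t
      using that by (auto simp: fibre_preserving_def pl NE pN)
  qed (auto simp: N0 k_def fibre_preserving_def)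
  have "homotopic_with (fibre_preserving E p p) E E (l \<circ> k) id"
    using lk by (rule homotopic_with_mono) (simp add: fibre_preserving_def)
  with lN have lgh: "homotopic_with (fibre_preserving E p p) E E (l \<circ> g \<circ> h) id"
    by (rule homotopic_with_trans)
  have lgg: "homotopic_with ?T E' E (l \<circ> g) g"
    by (rule homotopic_compose_cancel [OF l g])
  \<comment> \<open>On this side a plain homotopy suffices: \<open>l\<close> is homotopic to the
    identity, so \<open>h \<circ> l \<circ> g\<close> ~ \<open>h \<circ> g\<close> ~
    \<open>id\<close>.\<close>
  have "homotopic_with ?T E' E' (h \<circ> (l \<circ> g)) id"
    using homotopic_with_compose_continuous_map_left [OF lgg ch, of ?T] hg
      homotopic_with_trans by auto
  moreover have "homotopic_with ?T E E (l \<circ> g \<circ> h) id"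
    using lgh by (rule homotopic_with_mono) simp
  ultimately have "homotopy_equivalence_map E' E (l \<circ> g)"
    using ch continuous_map_compose [OF g cl] by (auto simp: homotopy_equivalence_map_def)
  moreover have "homotopy_equivalence_map B' B gbar"
    using gb chb gbhb hbgb by (auto simp: homotopy_equivalence_map_def)
  moreover have "p ((l \<circ> g) y) = gbar (p' y)" if "y \<in> topspace E'" for y
    using that continuous_map_image_subset_topspace [OF g] by (auto simp: pl pg image_subset_iff)
  ultimately show thesis using lgh by (rule that)
qed

section \<open>Monotonicity of sectional category\<close>

text \<open>A cover of \<open>B'\<close> pulls back along \<open>a\<close>, and a local homotopy
  section \<open>\<sigma>\<close> becomes \<open>c \<circ> \<sigma> \<circ> a\<close>, because
  \<open>p \<circ> c \<circ> \<sigma> \<circ> a = b \<circ> p' \<circ> \<sigma> \<circ> a\<close> ~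
  \<open>b \<circ> a\<close> ~ \<open>id\<close>.\<close>

lemma secat_le:
  assumes a: "continuous_map B B' a" and b: "continuous_map B' B b"
    and c: "continuous_map E' E c"
    and comm: "\<And>x. x \<in> topspace E' \<Longrightarrow> p (c x) = b (p' x)"
    and ba: "homotopic_with (\<lambda>_. True) B B (b \<circ> a) id"
  shows "secat E B p \<le> secat E' B' p'"
  unfolding secat_def
\<comment> \<open>It is enough that every \<open>k\<close> admissible for \<open>p'\<close> is
  admissible for \<open>p\<close>.\<close>
proof (rule Inf_superset_mono, clarify)
  fix k and U :: "nat \<Rightarrow> _"
  assume U: "\<forall>i\<le>k. openin B' (U i)" "(\<Union>i\<le>k. U i) = topspace B'"
    and sec: "\<forall>i\<le>k. \<exists>\<sigma>. continuous_map (subtopology B' (U i)) E' \<sigma> \<and>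
          homotopic_with (\<lambda>_. True) (subtopology B' (U i)) B' (p' \<circ> \<sigma>) id"
  define V where "V i = {x \<in> topspace B. a x \<in> U i}" for i
  have "\<forall>i\<le>k. openin B (V i)"
    using U(1) a by (auto simp: V_def intro: openin_continuous_map_preimage)
  moreover have "(\<Union>i\<le>k. V i) = topspace B"
    using U(2) continuous_map_image_subset_topspace [OF a] by (fastforce simp: V_def)
  moreover have "\<exists>\<sigma>. continuous_map (subtopology B (V i)) E \<sigma> \<and>
      homotopic_with (\<lambda>_. True) (subtopology B (V i)) B (p \<circ> \<sigma>) id" if "i \<le> k" for i
  proof -
    let ?V = "subtopology B (V i)"
    obtain \<sigma> where \<sigma>: "continuous_map (subtopology B' (U i)) E' \<sigma>"
      and hom: "homotopic_with (\<lambda>_. True) (subtopology B' (U i)) B' (p' \<circ> \<sigma>) id"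
      using sec \<open>i \<le> k\<close> by blast
    have aV: "continuous_map ?V (subtopology B' (U i)) a"
      using a by (auto simp: continuous_map_in_subtopology continuous_map_from_subtopology V_def)
    have \<sigma>a: "continuous_map ?V E' (\<sigma> \<circ> a)" by (rule continuous_map_compose [OF aV \<sigma>])
    have "homotopic_with (\<lambda>_. True) ?V B' (p' \<circ> \<sigma> \<circ> a) (id \<circ> a)"
      by (rule homotopic_with_compose_continuous_map_right [OF hom aV]) simp
    then have "homotopic_with (\<lambda>_. True) ?V B (b \<circ> (p' \<circ> \<sigma> \<circ> a)) (b \<circ> (id \<circ> a))"
      by (rule homotopic_with_compose_continuous_map_left [OF _ b]) simp
    then have "homotopic_with (\<lambda>_. True) ?V B (p \<circ> (c \<circ> (\<sigma> \<circ> a))) (b \<circ> a)"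
      by (rule homotopic_with_eq)
        (use continuous_map_image_subset_topspace [OF \<sigma>a] in \<open>auto simp: comm image_subset_iff\<close>)
    moreover have "homotopic_with (\<lambda>_. True) ?V B (b \<circ> a) id"
      using ba by (rule homotopic_from_subtopology)
    ultimately show ?thesis
      using homotopic_with_trans continuous_map_compose [OF \<sigma>a c] by blast
  qed
  ultimately show "\<exists>k'. enat k = enat k' \<and> (\<exists>U :: nat \<Rightarrow> _.
       (\<forall>i\<le>k'. openin B (U i)) \<and> (\<Union>i\<le>k'. U i) = topspace B \<and>
       (\<forall>i\<le>k'. \<exists>\<sigma>. continuous_map (subtopology B (U i)) E \<sigma> \<and>
          homotopic_with (\<lambda>_. True) (subtopology B (U i)) B (p \<circ> \<sigma>) id))"
    by blast
qed

section \<open>Functoriality of path spaces and fibre squares\<close>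

text \<open>The preimage of the subbasic set of \<open>K\<close> and \<open>U\<close> is that of
  \<open>K\<close> and the preimage of \<open>U\<close> under \<open>g\<close>. The restriction
  keeps the composite extensional and changes nothing on \<open>K\<close>.\<close>

lemma continuous_map_compact_open_compose:
  assumes g: "continuous_map Y Z g"
  shows "continuous_map (compact_open_topology X Y) (compact_open_topology X Z)
           (\<lambda>f. restrict (g \<circ> f) (topspace X))" (is "continuous_map _ _ ?c")
proof -
  have c: "continuous_map X Z (?c f)" if "continuous_map X Y f" for f
    using continuous_map_compose [OF that g] by (rule continuous_map_eq) simp
  let ?S = "\<lambda>K U. {f \<in> extensional (topspace X). continuous_map X Z f \<and> f ` K \<subseteq> U}"
  have pre: "openin (compact_open_topology X Y) (?c -` ?S K U \<inter> topspace (compact_open_topology X Y))"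
    if "compactin X K" "openin Z U" for K U
  proof -
    have K: "K \<subseteq> topspace X" using that by (simp add: compactin_subset_topspace)
    have "?c -` ?S K U \<inter> topspace (compact_open_topology X Y) =
        {f \<in> extensional (topspace X). continuous_map X Y f \<and> f ` K \<subseteq> {y \<in> topspace Y. g y \<in> U}}"
    proof -
      have "?c f \<in> ?S K U \<longleftrightarrow> f ` K \<subseteq> {y \<in> topspace Y. g y \<in> U}" if "continuous_map X Y f" for f
        using K c [OF that] continuous_map_image_subset_topspace [OF that]
        by (auto simp: image_subset_iff subset_iff)
      then show ?thesis unfolding topspace_compact_open_topology by blast
    qed
    moreover have "openin Y {y \<in> topspace Y. g y \<in> U}"
      using openin_continuous_map_preimage [OF g] that by blast
    ultimately show ?thesis
      unfolding compact_open_topology_def using that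
      by (intro topology_generated_by_Basis) auto
  qed
  have "?c f \<in> topspace (compact_open_topology X Z)" if "f \<in> topspace (compact_open_topology X Y)" for f
    using that c by (simp add: topspace_compact_open_topology)
  then show ?thesis
    using pre unfolding compact_open_topology_def [of X Z] topology_generated_by_topspace
    by (intro continuous_on_generated_topo) auto
qed

lemma continuous_map_fibrewise_path_space:
  assumes g: "continuous_map E' E g" and fp: "fibre_preserving E' p' p g"
  shows "continuous_map (fibrewise_path_space E' p') (fibrewise_path_space E p)
           (\<lambda>\<gamma>. restrict (g \<circ> \<gamma>) {0..1})"
proof -
  have "continuous_map (fibrewise_path_space E' p') (compact_open_topology (top_of_set {0..1}) E)
      (\<lambda>\<gamma>. restrict (g \<circ> \<gamma>) {0..1})"
    using continuous_map_compact_open_compose [OF g, of "top_of_set {0..1::real}"]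
    by (simp add: fibrewise_path_space_def continuous_map_from_subtopology)
  moreover have "restrict (g \<circ> \<gamma>) {0..1} \<in> {\<gamma>. \<forall>t\<in>{0..1}. p (\<gamma> t) = p (\<gamma> 0)}"
    if "\<gamma> \<in> topspace (fibrewise_path_space E' p')" for \<gamma>
  proof (intro CollectI ballI)
    fix t :: real assume t: "t \<in> {0..1}"
    have \<gamma>: "continuous_map (top_of_set {0..1}) E' \<gamma>" and "\<forall>t\<in>{0..1}. p' (\<gamma> t) = p' (\<gamma> 0)"
      using that unfolding fibrewise_path_space_def topspace_subtopology
        topspace_compact_open_topology by blast+
    then have eq: "p' (\<gamma> t) = p' (\<gamma> 0)" using t by blast
    have "p (g (\<gamma> t)) = p (g (\<gamma> 0))"
      using t continuous_map_image_subset_topspace [OF \<gamma>]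
      by (intro fibre_preservingD [OF fp _ _ eq]) (auto simp: image_subset_iff)
    with t show "p (restrict (g \<circ> \<gamma>) {0..1} t) = p (restrict (g \<circ> \<gamma>) {0..1} 0)"
      by simp
  qed
  ultimately show ?thesis
    by (subst fibrewise_path_space_def, intro continuous_map_into_subtopology) blast+
qed

lemma topspace_fibre_square:
  "topspace (fibre_square E p) = {(x, y). x \<in> topspace E \<and> y \<in> topspace E \<and> p x = p y}"
  by (auto simp: fibre_square_def)

lemma continuous_map_fibre_square:
  assumes "continuous_map E' E g" "fibre_preserving E' p' p g"
  shows "continuous_map (fibre_square E' p') (fibre_square E p) (map_prod g g)"
proof -
  have "continuous_map (prod_topology E' E') (prod_topology E E) (\<lambda>(x, y). (g x, g y))"
    using assms(1) by (simp add: continuous_map_prod_top)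
  then have "continuous_map (fibre_square E' p') (prod_topology E E) (map_prod g g)"
    by (simp add: fibre_square_def map_prod_def continuous_map_from_subtopology)
  then show ?thesis
    using assms(2) unfolding fibre_square_def [of E]
    by (auto simp: continuous_map_in_subtopology topspace_fibre_square intro: fibre_preservingD)
qed

text \<open>Each stage of the homotopy preserves fibres, so applying it to both coordinates never
  leaves the fibre square.\<close>

lemma homotopic_fibre_square:
  assumes "homotopic_with (fibre_preserving E p p) E E f g"
  shows "homotopic_with (\<lambda>_. True) (fibre_square E p) (fibre_square E p) (map_prod f f) (map_prod g g)"
proof -
  let ?I = "top_of_set {0..1::real}"
  obtain K where K: "continuous_map (prod_topology ?I E) E K"
    and K01: "\<And>x. K (0, x) = f x" "\<And>x. K (1, x) = g x"
    and fp: "\<And>t. t \<in> {0..1} \<Longrightarrow> fibre_preserving E p p (\<lambda>x. K (t, x))"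
    using assms by (auto simp: homotopic_with_def)
  let ?H = "\<lambda>z. (K (fst z, fst (snd z)), K (fst z, snd (snd z)))"
  let ?Z = "prod_topology ?I (fibre_square E p)"
  have sq: "continuous_map ?Z (prod_topology E E) snd"
    using continuous_map_snd continuous_map_into_fulltopology unfolding fibre_square_def by blast
  have fst: "continuous_map ?Z E (\<lambda>z. fst (snd z))" and snd: "continuous_map ?Z E (\<lambda>z. snd (snd z))"
    using continuous_map_compose [OF sq continuous_map_fst] continuous_map_compose [OF sq continuous_map_snd]
    by (simp_all add: o_def)
  have "continuous_map ?Z (prod_topology E E) ?H"
    unfolding continuous_map_paired
    by (intro conjI
        continuous_map_reparametrise [OF K continuous_map_unit_interval_fst _ fst]
        continuous_map_reparametrise [OF K continuous_map_unit_interval_fst _ snd]) auto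
  then have H: "continuous_map ?Z (fibre_square E p) ?H"
    by (subst fibre_square_def)
      (auto simp: continuous_map_in_subtopology topspace_fibre_square intro: fibre_preservingD [OF fp])
  show ?thesis
    by (rule homotopic_withI [OF H]) (auto simp: K01)
qed

section \<open>Comparison of the two complexities\<close>

text \<open>This is \<open>secat_le\<close> with \<open>h\<close> and \<open>g\<close> acting on
  pairs as \<open>a\<close> and \<open>b\<close>, and composition of paths with \<open>g\<close> as
  \<open>c\<close>.\<close>

lemma parametrised_TC_le:
  assumes h: "continuous_map E E' h" "fibre_preserving E p p' h"
    and g: "continuous_map E' E g" "fibre_preserving E' p' p g"
    and gh: "homotopic_with (fibre_preserving E p p) E E (g \<circ> h) id"
  shows "parametrised_TC E p \<le> parametrised_TC E' p'"
  unfolding parametrised_TC_def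
proof (rule secat_le)
  show "homotopic_with (\<lambda>_. True) (fibre_square E p) (fibre_square E p)
      (map_prod g g \<circ> map_prod h h) id"
    using homotopic_fibre_square [OF gh] by (simp add: map_prod_compose map_prod.id)
  show "endpoint_map (restrict (g \<circ> \<gamma>) {0..1}) = map_prod g g (endpoint_map \<gamma>)" for \<gamma>
    by (simp add: endpoint_map_def)
qed (intro continuous_map_fibre_square continuous_map_fibrewise_path_space h g)+

lemma fibration_map_TC_le:
  assumes fib: "hurewicz_fibration E B p" and p': "continuous_map E' B' p'"
    and h: "homotopy_equivalence_map E E' h" and hbar: "homotopy_equivalence_map B B' hbar"
    and comm: "\<And>x. x \<in> topspace E \<Longrightarrow> p' (h x) = hbar (p x)"
  obtains g gbar where "homotopy_equivalence_map E' E g" "homotopy_equivalence_map B' B gbar"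
    and "\<And>y. y \<in> topspace E' \<Longrightarrow> p (g y) = gbar (p' y)"
    and "parametrised_TC E p \<le> parametrised_TC E' p'"
proof -
  obtain g gbar where g: "homotopy_equivalence_map E' E g" "homotopy_equivalence_map B' B gbar"
    and pg: "\<And>y. y \<in> topspace E' \<Longrightarrow> p (g y) = gbar (p' y)"
    and gh: "homotopic_with (fibre_preserving E p p) E E (g \<circ> h) id"
    using fibration_map_left_inverse [OF fib p' h hbar comm] by blast
  have "parametrised_TC E p \<le> parametrised_TC E' p'"
    by (rule parametrised_TC_le [OF _ _ _ _ gh])
      (use h g in \<open>auto simp: fibre_preserving_def comm pg homotopy_equivalence_map_def\<close>)
  with g pg show thesis by (rule that)
qed

theorem proposition2p6:
  fixes E :: "'a topology" and B :: "'b topology" and p :: "'a \<Rightarrow> 'b"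
    and E' :: "'c topology" and B' :: "'d topology" and p' :: "'c \<Rightarrow> 'd"
    and h :: "'a \<Rightarrow> 'c" and hbar :: "'b \<Rightarrow> 'd"
  assumes "hurewicz_fibration E B p"
    and "hurewicz_fibration E' B' p'"
    and "homotopy_equivalence_map E E' h"
    and "homotopy_equivalence_map B B' hbar"
    and "\<forall>x\<in>topspace E. p' (h x) = hbar (p x)"
  shows "parametrised_TC E p = parametrised_TC E' p'"
proof -
  obtain g gbar where g: "homotopy_equivalence_map E' E g" "homotopy_equivalence_map B' B gbar"
    and pg: "\<And>y. y \<in> topspace E' \<Longrightarrow> p (g y) = gbar (p' y)"
    and le: "parametrised_TC E p \<le> parametrised_TC E' p'"
    using fibration_map_TC_le [OF assms(1) fibration_continuous_map [OF assms(2)] assms(3,4)]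
      assms(5) by blast
  \<comment> \<open>Here \<open>g\<close> takes the role of \<open>h\<close> and receives a left
    inverse of its own, which need not be \<open>h\<close>.\<close>
  have "parametrised_TC E' p' \<le> parametrised_TC E p"
    using fibration_map_TC_le [OF assms(2) fibration_continuous_map [OF assms(1)] g pg] by blast
  with le show ?thesis by (rule antisym)
qed

end
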